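(* Let $J\subseteq\mathbb{R}$ be a non-trivial interval, let $\Delta_J:=\{(s,t)\in J^2\mid s\leq t\}$, and let $\mathcal{S}$ be an at most countable (possibly empty) set of pairwise disjoint subintervals of $J$. Let furthermore $d\colon\bigcup_{I\in\mathcal{S}}I\to\mathbb{R}\setminus\{0\}$ be an arbitrary function. Let $f\colon\Delta_J\to\mathbb{R}$ be defined, for $(x,y)\in\Delta_J$, by $$f(x,y):=\begin{cases}\dfrac{d(y)}{d(x)}, & \text{if } x,y\in I \text{ for some } I\in\mathcal{S},\\[1ex] 0, & \text{if } x<y \text{ and there is no } I\in\mathcal{S} \text{ containing both } x \text{ and } y,\\ 0\text{ or }1, & \text{if } x=y\notin\bigcup_{I\in\mathcal{S}}I,\end{cases}$$ where in the last case the value $0$ or $1$ may be chosen arbitrarily for each such $x$. Then $f$ satisfies the Sincov equation $$f(s,t)f(t,u)=f(s,u)\quad\text{for all } (s,t),(t,u)\in\Delta_J.$$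
   Context: An interval is non-trivial if it contains more than one point. *)

theory Defs
  imports "HOL-Analysis.Analysis"
begin

definition nontrivial_interval :: "real set \<Rightarrow> bool" where
  "nontrivial_interval J \<longleftrightarrow> is_interval J \<and> (\<exists>a\<in>J. \<exists>b\<in>J. a \<noteq> b)"

definition Delta :: "real set \<Rightarrow> (real \<times> real) set" where
  "Delta J = {(s, t). s \<in> J \<and> t \<in> J \<and> s \<le> t}"

(* Functions on Delta J are total functions on pairs; only their values on Delta J matter. *)
definition satisfies_Sincov :: "real set \<Rightarrow> (real \<times> real \<Rightarrow> real) \<Rightarrow> bool" where
  "satisfies_Sincov J f \<longleftrightarrow>
     (\<forall>s t u. (s, t) \<in> Delta J \<longrightarrow> (t, u) \<in> Delta J \<longrightarrow> f (s, t) * f (t, u) = f (s, u))"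

end

(* Lying in a common member of S is a transitive relation on points, since the members are disjoint;
   it passes to intermediate points, since they are intervals. So for s <= t <= u, the points s and u
   are related iff s, t and t, u are. In that case the quotients telescope; otherwise both sides
   vanish, except possibly when s = t = u, where the equation says that f (s, s) is idempotent. *)
theory Submission imports Defs begin

theorem theorem6:
  fixes J :: "real set" and S :: "real set set"
    and d :: "real \<Rightarrow> real" and f :: "real \<times> real \<Rightarrow> real"
  assumes "nontrivial_interval J"
    and "countable S"
    and "\<And>I. I \<in> S \<Longrightarrow> is_interval I \<and> I \<subseteq> J"
    and "disjoint S"
    and "\<And>x. x \<in> \<Union>S \<Longrightarrow> d x \<noteq> 0"
    and "\<And>x y. (x, y) \<in> Delta J \<Longrightarrow> \<exists>I\<in>S. x \<in> I \<and> y \<in> I \<Longrightarrow> f (x, y) = d y / d x"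
    and "\<And>x y. (x, y) \<in> Delta J \<Longrightarrow> x < y \<Longrightarrow> \<not> (\<exists>I\<in>S. x \<in> I \<and> y \<in> I) \<Longrightarrow> f (x, y) = 0"
    and "\<And>x. (x, x) \<in> Delta J \<Longrightarrow> x \<notin> \<Union>S \<Longrightarrow> f (x, x) \<in> {0, 1}"
  shows "satisfies_Sincov J f"
proof -
  define R where "R x y \<longleftrightarrow> (\<exists>I\<in>S. x \<in> I \<and> y \<in> I)" for x y
  have R_trans: "R x z" if "R x y" "R y z" for x y z
    using that \<open>disjoint S\<close> unfolding R_def by (metis disjointD disjoint_iff)
  have R_between: "R x y \<and> R y z" if "R x z" "x \<le> y" "y \<le> z" for x y z
    using that assms(3) unfolding R_def by (meson is_interval_1)
  have f_R: "f (x, y) = d y / d x" if "(x, y) \<in> Delta J" "R x y" for x y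
    using assms(6) that unfolding R_def by blast
  have f_not_R: "f (x, y) = 0" if "(x, y) \<in> Delta J" "x < y" "\<not> R x y" for x y
    using assms(7) that unfolding R_def by blast
  \<comment> \<open>\<open>R x x\<close> holds exactly when \<open>x\<close> lies in some member of
    \<open>S\<close>, so its failure singles out the points where the diagonal value is chosen
    freely.\<close>
  have f_diag: "f (x, x) \<in> {0, 1}" if "(x, x) \<in> Delta J" "\<not> R x x" for x
    using assms(8) that unfolding R_def by blast
  have "f (s, t) * f (t, u) = f (s, u)"
    if st: "(s, t) \<in> Delta J" and tu: "(t, u) \<in> Delta J" for s t u
  proof -
    have le: "s \<le> t" "t \<le> u" and su: "(s, u) \<in> Delta J"
      using st tu by (auto simp: Delta_def)
    show ?thesis
    proof (cases "R s u")
      case True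
      then have R: "R s t" "R t u"
        using R_between le by blast+
      \<comment> \<open>The product of the two quotients telescopes only if \<open>d t\<close> can
        be cancelled.\<close>
      then have "d t \<noteq> 0"
        using assms(5) unfolding R_def by blast
      then show ?thesis
        using f_R[OF st R(1)] f_R[OF tu R(2)] f_R[OF su True] by simp
    next
      case not_R: False
      show ?thesis
      proof (cases "s = u")
        case True
        then have "t = s" "u = s"
          using le by auto
        then show ?thesis
          using f_diag su not_R by auto
      next
        case False
        then have su0: "f (s, u) = 0"
          using f_not_R su not_R le by simp
        have "\<not> R s t \<or> \<not> R t u"
          using R_trans not_R by blast
        \<comment> \<open>\<open>f_not_R\<close> needs a strict inequality. If \<open>s = t\<close>
          or \<open>t = u\<close>, one factor is a diagonal value, possibly 1, but the other is
          \<open>f (s, u)\<close> itself, which is 0 by \<open>su0\<close>.\<close>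
        then have "f (s, t) = 0 \<or> f (t, u) = 0"
          using f_not_R[OF st] f_not_R[OF tu] su0 le by (cases "s = t"; cases "t = u") auto
        then show ?thesis
          using su0 by auto
      qed
    qed
  qed
  then show ?thesis
    unfolding satisfies_Sincov_def by blast
qed

end
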